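(* Let $\|\cdot\|$ be any norm on $\mathbb{R}^2$. Then there exists a strong crescent configuration of size $4$ in $\|\cdot\|$.
   Context: A $\|\cdot\|$ circle is a set $\{q\in\mathbb{R}^2:\|q-p\|=r\}$ with $p\in\mathbb{R}^2$, $r>0$. A set $S\subset\mathbb{R}^2$ of $n$ points is a line-like configuration of size $n$ in $\|\cdot\|$ if its distance graph is isomorphic to that of $n$ equally spaced points on a line, i.e. there is a bijection $\phi: S\to\{1,\dots,n\}$ such that for all $a,b,c,d\in S$: $\|a-b\|=\|c-d\|$ if and only if $|\phi(a)-\phi(b)|=|\phi(c)-\phi(d)|$. A set of points lies in strong general position in $\|\cdot\|$ if (1) no three of its points lie on a common line, (2) no four of its points lie on a common $\|\cdot\|$ circle, and (3) no four of its points form a line-like configuration of size four in $\|\cdot\|$. A set of $n$ points in $\mathbb{R}^2$ is a strong crescent configuration of size $n$ in $\|\cdot\|$ if (1) it lies in strong general position in $\|\cdot\|$, (2) it determines exactly $n-1$ distinct (nonzero) distances, measured in $\|\cdot\|$, and (3) for each $1\leq i\leq n-1$ there is a distance which occurs with multiplicity exactly $i$ among the unordered pairs of distinct points. *)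

theory Defs
  imports "HOL-Analysis.Analysis"
begin

text \<open>
  An arbitrary norm on the plane is represented by a function \<open>N\<close> on \<open>real ^ 2\<close>;
  the type-class norm of \<open>real ^ 2\<close> is the Euclidean one and plays no role here.
\<close>

definition is_norm :: "(real ^ 2 \<Rightarrow> real) \<Rightarrow> bool" where
  "is_norm N \<longleftrightarrow>
     (\<forall>x. 0 \<le> N x) \<and>
     (\<forall>x. N x = 0 \<longleftrightarrow> x = 0) \<and>
     (\<forall>c x. N (c *\<^sub>R x) = \<bar>c\<bar> * N x) \<and>
     (\<forall>x y. N (x + y) \<le> N x + N y)"

definition is_circle :: "(real ^ 2 \<Rightarrow> real) \<Rightarrow> (real ^ 2) set \<Rightarrow> bool" where
  "is_circle N C \<longleftrightarrow> (\<exists>p r. r > 0 \<and> C = {q. N (q - p) = r})"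

text \<open>The labels are cast to \<open>int\<close> because subtraction on \<open>nat\<close> truncates.\<close>

definition line_like :: "(real ^ 2 \<Rightarrow> real) \<Rightarrow> nat \<Rightarrow> (real ^ 2) set \<Rightarrow> bool" where
  "line_like N n S \<longleftrightarrow>
     (\<exists>\<phi>. bij_betw \<phi> S {1..n} \<and>
        (\<forall>a\<in>S. \<forall>b\<in>S. \<forall>c\<in>S. \<forall>d\<in>S.
           N (a - b) = N (c - d) \<longleftrightarrow>
           \<bar>int (\<phi> a) - int (\<phi> b)\<bar> = \<bar>int (\<phi> c) - int (\<phi> d)\<bar>))"

definition strong_general_position :: "(real ^ 2 \<Rightarrow> real) \<Rightarrow> (real ^ 2) set \<Rightarrow> bool" where
  "strong_general_position N S \<longleftrightarrow>
     (\<forall>T\<subseteq>S. card T = 3 \<longrightarrow> \<not> collinear T) \<and>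
     (\<forall>T\<subseteq>S. card T = 4 \<longrightarrow> \<not> (\<exists>C. is_circle N C \<and> T \<subseteq> C)) \<and>
     (\<forall>T\<subseteq>S. card T = 4 \<longrightarrow> \<not> line_like N 4 T)"

definition distances :: "(real ^ 2 \<Rightarrow> real) \<Rightarrow> (real ^ 2) set \<Rightarrow> real set" where
  "distances N S = {N (x - y) | x y. x \<in> S \<and> y \<in> S \<and> x \<noteq> y}"

definition multiplicity_of_distance ::
    "(real ^ 2 \<Rightarrow> real) \<Rightarrow> (real ^ 2) set \<Rightarrow> real \<Rightarrow> nat" where
  "multiplicity_of_distance N S d =
     card {{x, y} | x y. x \<in> S \<and> y \<in> S \<and> x \<noteq> y \<and> N (x - y) = d}"

definition strong_crescent :: "(real ^ 2 \<Rightarrow> real) \<Rightarrow> nat \<Rightarrow> (real ^ 2) set \<Rightarrow> bool" where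
  "strong_crescent N n S \<longleftrightarrow>
     finite S \<and> card S = n \<and>
     strong_general_position N S \<and>
     card (distances N S) = n - 1 \<and>
     (\<forall>i\<in>{1..n - 1}. \<exists>d\<in>distances N S. multiplicity_of_distance N S d = i)"

end

theory Submission
  imports Defs
begin

text \<open>
  Take an equilateral triangle \<open>0, p, q\<close> of side \<open>1\<close> and a fourth point \<open>D\<close> in its interior,
  equidistant from \<open>p\<close> and \<open>q\<close>. Since \<open>D\<close> is interior, its distances to the vertices are less
  than \<open>1\<close> and no circle passes through all four points; an equilateral triangle does not embed
  into a line-like configuration. So it suffices that \<open>D\<close> is not equidistant from all three
  vertices. If \<open>D\<close> lies on the parallel to \<open>pq\<close> at ratio \<open>t < 1/2\<close> from \<open>0\<close>, then
  \<open>N D \<le> t < 1 - t \<le> N (D - p)\<close>. An intermediate value argument gives such a \<open>D\<close> strictly inside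
  the triangle when \<open>t\<close> is close to \<open>1/2\<close>, unless a median has length exactly \<open>1/2\<close>; in that
  case the unit ball is a parallelogram and the centroid works.
\<close>

section \<open>Convexity and continuity of an arbitrary norm\<close>

lemma is_norm_convex_on:
  assumes "is_norm N"
  shows "convex_on UNIV N"
proof (rule convex_onI)
  fix t :: real and x y :: "real ^ 2"
  assume t: "0 < t" "t < 1"
  have "N ((1 - t) *\<^sub>R x + t *\<^sub>R y) \<le> N ((1 - t) *\<^sub>R x) + N (t *\<^sub>R y)"
    using assms unfolding is_norm_def by blast
  also have "\<dots> = (1 - t) * N x + t * N y"
    using assms t unfolding is_norm_def by simp
  finally show "N ((1 - t) *\<^sub>R x + t *\<^sub>R y) \<le> (1 - t) * N x + t * N y" .
qed simp

text \<open>In finite dimension a convex function on an open set is continuous, so the intermediate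
  value theorem applies to \<open>N\<close> without comparing it with the Euclidean norm.\<close>

lemma is_norm_continuous_on:
  assumes "is_norm N"
  shows "continuous_on UNIV N"
  by (rule convex_on_continuous[OF open_UNIV is_norm_convex_on[OF assms]])

lemma continuous_on_is_norm [continuous_intros]:
  assumes "is_norm N" "continuous_on A f"
  shows "continuous_on A (\<lambda>x. N (f x))"
  using continuous_on_compose2[OF is_norm_continuous_on[OF assms(1)] assms(2)] by simp

section \<open>Norm calculus and existence of an equilateral triangle\<close>

locale plane_norm =
  fixes N :: "real ^ 2 \<Rightarrow> real"
  assumes is_norm: "is_norm N"
begin

lemma nonneg: "0 \<le> N x"
  and eq_0_iff [simp]: "N x = 0 \<longleftrightarrow> x = 0"
  and scale: "N (c *\<^sub>R x) = \<bar>c\<bar> * N x"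
  and triangle: "N (x + y) \<le> N x + N y"
  using is_norm by (auto simp: is_norm_def)

lemma zero [simp]: "N 0 = 0"
  by simp

lemma minus [simp]: "N (- x) = N x"
  using scale[of "-1" x] by simp

lemma minus_commute: "N (x - y) = N (y - x)"
  using minus[of "x - y"] by simp

lemma triangle_diff: "N x \<le> N (x - y) + N y"
  using triangle[of "x - y" y] by simp

lemma comb_le: "N (a *\<^sub>R x + b *\<^sub>R y) \<le> \<bar>a\<bar> * N x + \<bar>b\<bar> * N y"
  using triangle[of "a *\<^sub>R x" "b *\<^sub>R y"] by (simp add: scale)

text \<open>Rescaling the Euclidean half circle to the unit circle of \<open>N\<close> gives a path
  of unit vectors from \<open>h 0\<close> to its antipode. The distance to \<open>h 0\<close> rises
  from 0 to 2 along it, so it takes the value 1.\<close>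

lemma exists_equilateral: "\<exists>p q. N p = 1 \<and> N q = 1 \<and> N (p - q) = 1"
proof -
  define e f :: "real ^ 2" where "e = axis 1 1" and "f = axis 2 1"
  define g where "g \<theta> = cos \<theta> *\<^sub>R e + sin \<theta> *\<^sub>R f" for \<theta>
  define h where "h \<theta> = (1 / N (g \<theta>)) *\<^sub>R g \<theta>" for \<theta>
  have g0: "g \<theta> \<noteq> 0" for \<theta>
  proof
    assume "g \<theta> = 0"
    then have "g \<theta> $ 1 = 0" "g \<theta> $ 2 = 0" by auto
    then have "cos \<theta> = 0" "sin \<theta> = 0" by (auto simp: g_def e_def f_def axis_def)
    then show False using sin_cos_squared_add[of \<theta>] by simp
  qed
  have Nh: "N (h \<theta>) = 1" for \<theta>
    using g0[of \<theta>] nonneg[of "g \<theta>"] by (simp add: h_def scale)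
  have hpi: "h pi = - h 0"
    by (simp add: h_def g_def)
  have "continuous_on {0..pi} h"
    unfolding h_def g_def
    by (intro continuous_intros is_norm ballI) (use g0 in \<open>simp add: g_def\<close>)
  then have "continuous_on {0..pi} (\<lambda>\<theta>. N (h 0 - h \<theta>))"
    by (intro continuous_intros is_norm)
  moreover have "h 0 - h pi = 2 *\<^sub>R h 0"
    by (simp add: hpi scaleR_2)
  then have "N (h 0 - h pi) = 2"
    by (simp add: scale Nh)
  ultimately obtain \<theta> where "N (h 0 - h \<theta>) = 1"
    using IVT'[of "\<lambda>\<theta>. N (h 0 - h \<theta>)" 0 1 pi] by auto
  then show ?thesis using Nh by blast
qed

end

section \<open>Coordinates with respect to an equilateral triangle\<close>

locale equilateral = plane_norm +
  fixes p q :: "real ^ 2"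
  assumes Np: "N p = 1" and Nq: "N q = 1" and Npq: "N (p - q) = 1"
begin

text \<open>If \<open>q\<close> were a multiple \<open>c\<close> of \<open>p\<close>, both
  \<open>c\<close> and \<open>1 - c\<close> would have absolute value 1, which no real number
  satisfies.\<close>

lemma det_nonzero: "p $ 1 * q $ 2 - p $ 2 * q $ 1 \<noteq> 0"
proof
  assume det: "p $ 1 * q $ 2 - p $ 2 * q $ 1 = 0"
  have "p \<noteq> 0" using Np eq_0_iff[of p] by auto
  then have "p $ 1 \<noteq> 0 \<or> p $ 2 \<noteq> 0" by (simp add: vec_eq_iff forall_2)
  then obtain c where c: "q = c *\<^sub>R p"
  proof
    assume "p $ 1 \<noteq> 0"
    then have "q = (q $ 1 / p $ 1) *\<^sub>R p"
      using det by (simp add: vec_eq_iff forall_2 field_simps)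
    then show ?thesis using that by blast
  next
    assume "p $ 2 \<noteq> 0"
    then have "q = (q $ 2 / p $ 2) *\<^sub>R p"
      using det by (simp add: vec_eq_iff forall_2 field_simps)
    then show ?thesis using that by blast
  qed
  have "p - q = (1 - c) *\<^sub>R p" by (simp add: c algebra_simps)
  then have "\<bar>1 - c\<bar> = 1" "\<bar>c\<bar> = 1"
    using Npq Nq Np by (auto simp: c scale)
  then show False by auto
qed

lemma independent:
  assumes "x *\<^sub>R p + y *\<^sub>R q = 0"
  shows "x = 0 \<and> y = 0"
proof -
  have 1: "x * p $ 1 + y * q $ 1 = 0" and 2: "x * p $ 2 + y * q $ 2 = 0"
    using assms by (auto simp: vec_eq_iff forall_2)
  have "x * (p $ 1 * q $ 2 - p $ 2 * q $ 1) = 0" "y * (p $ 1 * q $ 2 - p $ 2 * q $ 1) = 0"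
    using 1 2 by algebra+
  then show ?thesis using det_nonzero by simp
qed

lemma obtain_coordinates:
  obtains x y where "z = x *\<^sub>R p + y *\<^sub>R q"
proof -
  define d where "d = p $ 1 * q $ 2 - p $ 2 * q $ 1"
  have "d \<noteq> 0" using det_nonzero by (simp add: d_def)
  then have "z = ((z $ 1 * q $ 2 - z $ 2 * q $ 1) / d) *\<^sub>R p + ((p $ 1 * z $ 2 - p $ 2 * z $ 1) / d) *\<^sub>R q"
    by (simp add: vec_eq_iff forall_2 field_simps) (simp add: d_def algebra_simps)
  then show ?thesis using that by blast
qed

lemma collinear_coordinates:
  assumes "collinear {0, x1 *\<^sub>R p + y1 *\<^sub>R q, x2 *\<^sub>R p + y2 *\<^sub>R q}"
  shows "x1 * y2 = x2 * y1"
proof -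
  consider "x1 *\<^sub>R p + y1 *\<^sub>R q = 0" | "x2 *\<^sub>R p + y2 *\<^sub>R q = 0"
    | c where "x2 *\<^sub>R p + y2 *\<^sub>R q = c *\<^sub>R (x1 *\<^sub>R p + y1 *\<^sub>R q)"
    using assms unfolding collinear_lemma by blast
  then show ?thesis
  proof cases
    case 3
    then have "(x2 - c * x1) *\<^sub>R p + (y2 - c * y1) *\<^sub>R q = 0"
      by (simp add: algebra_simps)
    then have "x2 = c * x1" "y2 = c * y1" using independent by fastforce+
    then show ?thesis by simp
  qed (use independent in fastforce)+
qed

section \<open>Interior points that complete the triangle to a crescent\<close>

text \<open>The sides give distance 1 three times, the segments from \<open>D\<close> to
  \<open>p\<close> and \<open>q\<close> give \<open>b\<close> twice, and the one from
  \<open>D\<close> to 0 gives \<open>c\<close> once. These values differ because \<open>b\<close>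
  and \<open>c\<close> are below 1 and \<open>neq\<close> separates them.\<close>

lemma strong_crescent_interior_point:
  assumes pos: "\<alpha> > 0" "\<beta> > 0" "\<alpha> + \<beta> < 1"
    and D: "D = \<alpha> *\<^sub>R p + \<beta> *\<^sub>R q"
    and eq: "N (D - p) = N (D - q)" and neq: "N (D - p) \<noteq> N D"
  shows "strong_crescent N 4 {0, p, q, D}"
proof -
  define S where "S = {0, p, q, D}"
  define b c where "b = N (D - q)" and "c = N D"
  have ND: "N (D - p) = b" "N (p - D) = b" "N (D - q) = b" "N (q - D) = b" "N D = c" "N (q - p) = 1"
    using eq Npq by (simp_all add: b_def c_def minus_commute[of p D] minus_commute[of q D] minus_commute[of q p])
  have bc: "b \<noteq> c" using neq by (simp add: ND)
  have c1: "c < 1"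
    using comb_le[of \<alpha> p \<beta> q] pos by (simp add: Np Nq D c_def)
  \<comment> \<open>Expressed through the two sides at \<open>p\<close>, the absolute weights add up
    to 1 - \<alpha>, which is below 1.\<close>
  have Dp: "D - p = \<beta> *\<^sub>R (q - p) + (- (1 - \<alpha> - \<beta>)) *\<^sub>R p"
    by (simp add: D algebra_simps)
  have "N (D - p) \<le> \<bar>\<beta>\<bar> * N (q - p) + \<bar>- (1 - \<alpha> - \<beta>)\<bar> * N p"
    unfolding Dp by (rule comb_le)
  then have b1: "b < 1"
    using pos by (simp add: Np ND)
  have D0: "D \<noteq> 0" using independent[of \<alpha> \<beta>] pos D by auto
  have dist: "0 \<noteq> p" "0 \<noteq> q" "p \<noteq> q" "D \<noteq> p" "D \<noteq> q" "D \<noteq> 0"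
    using Np Nq Npq D0 c1 ND by auto
  have card: "card S = 4" "finite S"
    using dist by (auto simp: S_def)
  have ncol: "\<not> collinear {0, p, q}" "\<not> collinear {0, p, D}" "\<not> collinear {0, q, D}" "\<not> collinear {p, q, D}"
  proof -
    show "\<not> collinear {0, p, q}"
      using collinear_coordinates[of 1 0 0 1] by auto
    show "\<not> collinear {0, p, D}"
      using collinear_coordinates[of 1 0 \<alpha> \<beta>] pos D by auto
    show "\<not> collinear {0, q, D}"
      using collinear_coordinates[of 0 1 \<alpha> \<beta>] pos D by auto
    \<comment> \<open>Translating \<open>q\<close> to the origin makes
      \<open>collinear_coordinates\<close> applicable; collinearity would force \<alpha> + \<beta> =
      1.\<close>
    have "D - q = \<alpha> *\<^sub>R p + (\<beta> - 1) *\<^sub>R q" "p - q = 1 *\<^sub>R p + (-1) *\<^sub>R q"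
      by (simp_all add: D algebra_simps)
    then show "\<not> collinear {p, q, D}"
      using collinear_coordinates[of 1 "-1" \<alpha> "\<beta> - 1"] pos collinear_3[of p q D] by auto
  qed
  have three: "\<not> collinear T" if T: "T \<subseteq> S" "card T = 3" for T
  proof -
    have "card (S - T) = 1"
      using T card by (simp add: card_Diff_subset finite_subset)
    then obtain x where "S - T = {x}" by (rule card_1_singletonE)
    then have "T = S - {x}" "x \<in> S" using T by auto
    then have "T = {p, q, D} \<or> T = {0, q, D} \<or> T = {0, p, D} \<or> T = {0, p, q}"
      using dist by (auto simp: S_def)
    then show ?thesis using ncol by auto
  qed
  have four: "T = S" if "T \<subseteq> S" "card T = 4" for T
    using that card by (simp add: card_subset_eq)
  \<comment> \<open>Pushing \<open>D\<close> slightly away from a supposed centre \<open>P\<close>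
    keeps it in the triangle, so by convexity its distance from \<open>P\<close> is at most
    \<open>r\<close>. But that distance is (1 + \<epsilon>) times \<open>r\<close>.\<close>
  have circ: "\<not> (\<exists>C. is_circle N C \<and> S \<subseteq> C)"
  proof
    assume "\<exists>C. is_circle N C \<and> S \<subseteq> C"
    then obtain P r where r: "r > 0" "N (0 - P) = r" "N (p - P) = r" "N (q - P) = r" "N (D - P) = r"
      unfolding is_circle_def S_def by auto
    obtain x y where P: "P = x *\<^sub>R p + y *\<^sub>R q" by (rule obtain_coordinates)
    \<comment> \<open>\<open>m\<close> is the least barycentric coordinate of \<open>D\<close>, and
      \<open>k\<close> bounds the difference of each barycentric coordinate between \<open>D\<close>
      and \<open>P\<close>. Hence the push by \<epsilon> = m / k makes no coordinate negative; the
      summand 1 keeps \<open>k\<close> positive.\<close>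
    define k where "k = 1 + \<bar>\<alpha> - x\<bar> + \<bar>\<beta> - y\<bar>"
    define m where "m = min \<alpha> (min \<beta> (1 - \<alpha> - \<beta>))"
    define \<epsilon> where "\<epsilon> = m / k"
    have m: "m > 0" "m \<le> \<alpha>" "m \<le> \<beta>" "m \<le> 1 - \<alpha> - \<beta>" using pos by (auto simp: m_def)
    have k: "k > 0" by (simp add: k_def)
    have \<epsilon>: "\<epsilon> > 0" using m k by (simp add: \<epsilon>_def)
    have bound: "\<bar>\<epsilon> * z\<bar> \<le> m" if "\<bar>z\<bar> \<le> k" for z
    proof -
      have "\<bar>\<epsilon> * z\<bar> = m * (\<bar>z\<bar> / k)" using m k by (simp add: \<epsilon>_def abs_mult)
      also have "\<dots> \<le> m * 1" using m k that by (intro mult_left_mono) auto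
      finally show ?thesis by simp
    qed
    define u v where "u = \<alpha> + \<epsilon> * (\<alpha> - x)" and "v = \<beta> + \<epsilon> * (\<beta> - y)"
    have u: "u \<ge> 0" using bound[of "\<alpha> - x"] m by (auto simp: k_def u_def)
    have v: "v \<ge> 0" using bound[of "\<beta> - y"] m by (auto simp: k_def v_def)
    have "\<bar>\<epsilon> * ((\<alpha> - x) + (\<beta> - y))\<bar> \<le> m"
      by (rule bound) (auto simp: k_def)
    then have w: "1 - u - v \<ge> 0"
      using m by (simp add: u_def v_def algebra_simps)
    have "(1 + \<epsilon>) *\<^sub>R (D - P) = (1 - u - v) *\<^sub>R (0 - P) + (u *\<^sub>R (p - P) + v *\<^sub>R (q - P))"
      by (simp add: u_def v_def D P algebra_simps)
    then have "(1 + \<epsilon>) * r = N ((1 - u - v) *\<^sub>R (0 - P) + (u *\<^sub>R (p - P) + v *\<^sub>R (q - P)))"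
      using scale[of "1 + \<epsilon>" "D - P"] \<epsilon> r by simp
    also have "\<dots> \<le> N ((1 - u - v) *\<^sub>R (0 - P)) + N (u *\<^sub>R (p - P) + v *\<^sub>R (q - P))"
      by (rule triangle)
    also have "\<dots> \<le> (1 - u - v) * r + (u * r + v * r)"
      using comb_le[of u "p - P" v "q - P"] scale[of "1 - u - v" "0 - P"] u v w r by simp
    also have "\<dots> = r" by (simp add: algebra_simps)
    finally show False using mult_pos_pos[OF \<epsilon> r(1)] by (simp add: algebra_simps)
  qed
  have line: "\<not> line_like N 4 S"
  proof
    assume "line_like N 4 S"
    then obtain \<phi> :: "real ^ 2 \<Rightarrow> nat" where bij: "bij_betw \<phi> S {1..4}"
      and \<phi>: "\<forall>a\<in>S. \<forall>b\<in>S. \<forall>c\<in>S. \<forall>d\<in>S. N (a - b) = N (c - d) \<longleftrightarrow>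
           \<bar>int (\<phi> a) - int (\<phi> b)\<bar> = \<bar>int (\<phi> c) - int (\<phi> d)\<bar>"
      unfolding line_like_def by blast
    \<comment> \<open>The equal sides would force three distinct integers to be pairwise equally far
      apart.\<close>
    have S: "0 \<in> S" "p \<in> S" "q \<in> S" by (auto simp: S_def)
    have "\<phi> 0 \<noteq> \<phi> p" "\<phi> 0 \<noteq> \<phi> q" "\<phi> p \<noteq> \<phi> q"
      using bij S dist unfolding bij_betw_def inj_on_def by metis+
    moreover have "\<bar>int (\<phi> p) - int (\<phi> 0)\<bar> = \<bar>int (\<phi> q) - int (\<phi> 0)\<bar>"
      "\<bar>int (\<phi> p) - int (\<phi> 0)\<bar> = \<bar>int (\<phi> p) - int (\<phi> q)\<bar>"
      using \<phi>[rule_format, of p 0 q 0] \<phi>[rule_format, of p 0 p q] S Np Nq Npq by auto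
    ultimately show False by linarith
  qed
  have pairs: "(x, y) \<in> {(0,p),(p,0),(0,q),(q,0),(p,q),(q,p),(0,D),(D,0),(p,D),(D,p),(q,D),(D,q)}"
    if "x \<in> S" "y \<in> S" "x \<noteq> y" for x y
    using that by (auto simp: S_def)
  have distances: "distances N S = {1, b, c}"
  proof
    show "distances N S \<subseteq> {1, b, c}"
      unfolding distances_def using pairs by (force simp: ND Np Nq Npq)
    have "N (x - y) \<in> distances N S" if "x \<in> S" "y \<in> S" "x \<noteq> y" for x y
      unfolding distances_def using that by blast
    from this[of p 0] this[of D q] this[of D 0]
    show "{1, b, c} \<subseteq> distances N S" using dist by (simp add: S_def ND Np)
  qed
  \<comment> \<open>\<open>F\<close> needs only one orientation of each pair at distance
    \<open>d\<close>; forgetting the order turns the multiplicity into the size of an explicit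
    set.\<close>
  have mult: "multiplicity_of_distance N S d = card ((\<lambda>(x, y). {x, y}) ` F)"
    if "\<And>x y. x \<in> S \<Longrightarrow> y \<in> S \<Longrightarrow> x \<noteq> y \<Longrightarrow> N (x - y) = d \<Longrightarrow> (x, y) \<in> F \<or> (y, x) \<in> F"
      and "\<And>x y. (x, y) \<in> F \<Longrightarrow> x \<in> S \<and> y \<in> S \<and> x \<noteq> y \<and> N (x - y) = d" for d F
  proof -
    have "{{x, y} |x y. x \<in> S \<and> y \<in> S \<and> x \<noteq> y \<and> N (x - y) = d} = (\<lambda>(x, y). {x, y}) ` F"
      using that by (fastforce simp: insert_commute)
    then show ?thesis unfolding multiplicity_of_distance_def by (rule arg_cong)
  qed
  have "multiplicity_of_distance N S c = card ((\<lambda>(x, y). {x, y}) ` {(D, 0)})"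
  proof (rule mult)
    fix x y assume "x \<in> S" "y \<in> S" "x \<noteq> y" "N (x - y) = c"
    then show "(x, y) \<in> {(D, 0)} \<or> (y, x) \<in> {(D, 0)}"
      using pairs[of x y] bc c1 by (auto simp: ND Np Nq Npq)
  next
    fix x y :: "real ^ 2" assume "(x, y) \<in> {(D, 0)}"
    then show "x \<in> S \<and> y \<in> S \<and> x \<noteq> y \<and> N (x - y) = c"
      using dist ND Np Nq Npq by (auto simp: S_def)
  qed
  then have m1: "multiplicity_of_distance N S c = 1"
    using dist by (simp add: doubleton_eq_iff)
  have "multiplicity_of_distance N S b = card ((\<lambda>(x, y). {x, y}) ` {(p, D), (q, D)})"
  proof (rule mult)
    fix x y assume "x \<in> S" "y \<in> S" "x \<noteq> y" "N (x - y) = b"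
    then show "(x, y) \<in> {(p, D), (q, D)} \<or> (y, x) \<in> {(p, D), (q, D)}"
      using pairs[of x y] bc b1 by (auto simp: ND Np Nq Npq)
  next
    fix x y :: "real ^ 2" assume "(x, y) \<in> {(p, D), (q, D)}"
    then show "x \<in> S \<and> y \<in> S \<and> x \<noteq> y \<and> N (x - y) = b"
      using dist ND Np Nq Npq by (auto simp: S_def)
  qed
  then have m2: "multiplicity_of_distance N S b = 2"
    using dist by (simp add: doubleton_eq_iff)
  have "multiplicity_of_distance N S 1 = card ((\<lambda>(x, y). {x, y}) ` {(p, 0), (q, 0), (p, q)})"
  proof (rule mult)
    fix x y assume "x \<in> S" "y \<in> S" "x \<noteq> y" "N (x - y) = 1"
    then show "(x, y) \<in> {(p, 0), (q, 0), (p, q)} \<or> (y, x) \<in> {(p, 0), (q, 0), (p, q)}"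
      using pairs[of x y] b1 c1 by (auto simp: ND Np Nq Npq)
  next
    fix x y :: "real ^ 2" assume "(x, y) \<in> {(p, 0), (q, 0), (p, q)}"
    then show "x \<in> S \<and> y \<in> S \<and> x \<noteq> y \<and> N (x - y) = 1"
      using dist ND Np Nq Npq by (auto simp: S_def)
  qed
  then have m3: "multiplicity_of_distance N S 1 = 3"
    using dist by (simp add: doubleton_eq_iff)
  have "{1..4 - 1} = {1, 2, 3::nat}" by auto
  then have "\<forall>i\<in>{1..4 - 1}. \<exists>d\<in>distances N S. multiplicity_of_distance N S d = i"
    using m1 m2 m3 by (auto simp: distances)
  moreover have "card (distances N S) = 4 - 1"
    using b1 c1 bc by (simp add: distances)
  moreover have "strong_general_position N S"
    unfolding strong_general_position_def using three four circ line by blast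
  ultimately show ?thesis
    using card unfolding strong_crescent_def S_def by blast
qed

section \<open>Choice of the fourth point according to the medians\<close>

text \<open>The assumption says that the median from 0 has length 1/2. The centroid is then at
  distance 1/3 from 0, while two triangle inequalities pin its distance to \<open>p\<close> and
  \<open>q\<close> at 2/3.\<close>

lemma short_median:
  assumes "N (p + q) = 1"
  shows "strong_crescent N 4 {0, p, q, (1/3) *\<^sub>R p + (1/3) *\<^sub>R q}"
proof (rule strong_crescent_interior_point)
  let ?D = "(1/3) *\<^sub>R p + (1/3) *\<^sub>R q"
  have ND: "N ?D = 1/3"
    using scale[of "1/3" "p + q"] assms by (simp add: algebra_simps)
  have dist: "N (?D - u) = 2/3" if "N u = 1" "N v = 1" "N (u - v) = 1" "u + v = p + q" for u v
  proof -
    have "(3/2) *\<^sub>R u = (3/2) *\<^sub>R (u - ?D) + (1/2) *\<^sub>R (p + q)" by (simp add: algebra_simps)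
    then have "3/2 \<le> 3/2 * N (u - ?D) + 1/2"
      using comb_le[of "3/2" "u - ?D" "1/2" "p + q"] scale[of "3/2" u] assms that(1) by simp
    moreover have "?D = (1/3) *\<^sub>R (u + v)" using that(4) by (simp add: algebra_simps)
    then have "u - ?D = (1/3) *\<^sub>R u + (1/3) *\<^sub>R (u - v)"
      by (simp add: vec_eq_iff field_simps)
    then have "N (u - ?D) \<le> 2/3"
      using comb_le[of "1/3" u "1/3" "u - v"] that by simp
    ultimately show ?thesis by (simp add: minus_commute)
  qed
  have "N (?D - p) = 2/3" "N (?D - q) = 2/3"
    using dist[of p q] dist[of q p] Np Nq Npq by (auto simp: minus_commute add.commute)
  then show "N (?D - p) = N (?D - q)" "N (?D - p) \<noteq> N ?D"
    using ND by auto
qed auto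

text \<open>These are twice the lengths of the medians from \<open>q\<close> and \<open>p\<close>,
  so a value different from 1 leaves a positive gap.\<close>

lemma median_ge: "N (2 *\<^sub>R q - p) \<ge> 1" "N (2 *\<^sub>R p - q) \<ge> 1"
proof -
  have "N (2 *\<^sub>R q) = 2" "N (2 *\<^sub>R p) = 2" by (simp_all add: scale Np Nq)
  then show "N (2 *\<^sub>R q - p) \<ge> 1" "N (2 *\<^sub>R p - q) \<ge> 1"
    using triangle_diff[of "2 *\<^sub>R q" p] triangle_diff[of "2 *\<^sub>R p" q] Np Nq by auto
qed

lemma long_medians:
  assumes "N (2 *\<^sub>R q - p) \<noteq> 1" "N (2 *\<^sub>R p - q) \<noteq> 1"
  shows "\<exists>S. strong_crescent N 4 S"
proof -
  \<comment> \<open>The cap at 1 keeps \<open>t\<close> positive. With \<open>t\<close> as below,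
    the end point on the side from 0 to \<open>u\<close> is at distance 1/2 + \<delta>/8 from
    \<open>u\<close> but at least 1/2 + 3\<delta>/8 from the other vertex \<open>v\<close>.\<close>
  define \<delta> where "\<delta> = min 1 (min (N (2 *\<^sub>R q - p)) (N (2 *\<^sub>R p - q)) - 1)"
  have \<delta>: "0 < \<delta>" "\<delta> \<le> 1" "1 + \<delta> \<le> N (2 *\<^sub>R q - p)" "1 + \<delta> \<le> N (2 *\<^sub>R p - q)"
    using assms median_ge by (auto simp: \<delta>_def)
  define t where "t = 1/2 - \<delta>/8"
  have t: "0 < t" "t < 1/2" using \<delta> by (auto simp: t_def)
  have end_point: "N (t *\<^sub>R u - u) < N (t *\<^sub>R u - v)"
    if u: "N u = 1" and median: "1 + \<delta> \<le> N (2 *\<^sub>R v - u)" for u v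
  proof -
    have "N (t *\<^sub>R u - u) = 1 - t"
      using scale[of "t - 1" u] u t by (simp add: algebra_simps)
    moreover have "2 *\<^sub>R v - u = (-2) *\<^sub>R (t *\<^sub>R u - v) + (- (1 - 2 * t)) *\<^sub>R u"
      by (simp add: algebra_simps)
    then have "N (2 *\<^sub>R v - u) \<le> 2 * N (t *\<^sub>R u - v) + (1 - 2 * t)"
      using comb_le[of "-2" "t *\<^sub>R u - v" "- (1 - 2 * t)" u] u t by simp
    ultimately show ?thesis using median \<delta>(1) by (simp add: t_def)
  qed
  define D where "D s = (t * (1 - s)) *\<^sub>R p + (t * s) *\<^sub>R q" for s
  define f where "f s = N (D s - p) - N (D s - q)" for s
  have f0: "f 0 < 0" using end_point[of p q] \<delta> Np by (simp add: f_def D_def)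
  have f1: "f 1 > 0" using end_point[of q p] \<delta> Nq by (simp add: f_def D_def)
  have "continuous_on {0..1} f"
    unfolding f_def D_def by (intro continuous_intros is_norm)
  then obtain s where s: "0 \<le> s" "s \<le> 1" "f s = 0"
    using IVT'[of f 0 0 1] f0 f1 by auto
  \<comment> \<open>The strict signs at both ends keep \<open>D s\<close> off the sides through
    0.\<close>
  then have s01: "0 < s" "s < 1" using f0 f1 by (auto simp: less_le)
  have "N (D s) \<le> t * (1 - s) + t * s"
    using comb_le[of "t * (1 - s)" p "t * s" q] t s Np Nq by (simp add: D_def)
  then have "N (D s) \<le> t" by (simp add: algebra_simps)
  moreover have "1 \<le> N (p - D s) + N (D s)" using triangle_diff[of p "D s"] Np by simp
  ultimately have "N (D s - p) \<noteq> N (D s)" using t by (simp add: minus_commute)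
  moreover have "t * (1 - s) + t * s < 1" using t by (simp add: algebra_simps)
  ultimately have "strong_crescent N 4 {0, p, q, D s}"
    using strong_crescent_interior_point[of "t * (1 - s)" "t * s" "D s"] s s01 t
    by (simp add: f_def D_def)
  then show ?thesis by blast
qed

lemma exists_strong_crescent: "\<exists>S. strong_crescent N 4 S"
proof (cases "N (2 *\<^sub>R q - p) = 1 \<or> N (2 *\<^sub>R p - q) = 1")
  case True
  then show ?thesis
  proof
    assume "N (2 *\<^sub>R q - p) = 1"
    \<comment> \<open>The point reflection x -> q - x moves the vertex with the short median to the
      origin, as \<open>short_median\<close> requires; the other case reflects by x -> p -
      x.\<close>
    then interpret e: equilateral N q "q - p"
      using Np Nq Npq by unfold_locales (auto simp: minus_commute)
    show ?thesis using e.short_median \<open>N (2 *\<^sub>R q - p) = 1\<close> by (force simp: scaleR_2)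
  next
    assume "N (2 *\<^sub>R p - q) = 1"
    then interpret e: equilateral N p "p - q"
      using Np Nq Npq by unfold_locales (auto simp: minus_commute)
    show ?thesis using e.short_median \<open>N (2 *\<^sub>R p - q) = 1\<close> by (force simp: scaleR_2)
  qed
next
  case False
  then show ?thesis using long_medians by blast
qed

end

theorem theorem1p6:
  fixes N :: "real ^ 2 \<Rightarrow> real"
  assumes "is_norm N"
  shows "\<exists>S. strong_crescent N 4 S"
proof -
  interpret plane_norm N by unfold_locales (rule assms)
  obtain p q where "N p = 1" "N q = 1" "N (p - q) = 1"
    using exists_equilateral by blast
  then interpret equilateral N p q by unfold_locales
  show ?thesis by (rule exists_strong_crescent)
qed

end
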